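(* Assume: (a) $\operatorname{dom}f\subset\bigcap_{t\in T}\operatorname{dom}f_t$. (b) $T$ is a convex and compact subset of some locally convex space. (c) For each $x\in\bigcap_{t\in T}\operatorname{dom}f_t$, the function $T\ni t\mapsto f_t(x)$ is concave and upper semicontinuous on $T$. (d) There exists $\bar x\in\operatorname{dom}f$ such that $f_t(\bar x)<0$ for all $t\in T$. Then $\mathcal{H}_1$-stable strong duality holds, i.e. for every $x^*\in X^*$, $$(f+\delta_E)^*(x^* )=\min_{(t,\mu)\in T\times\mathbb{R}_+}(f+\mu f_t)^*(x^* ).$$ In particular, $$-\infty\le\inf(\mathrm{P})=\max(\mathrm{D}_{\mathcal{H}_1})<+\infty.$$
   Context: $X$ is a locally convex Hausdorff (real) topological vector space with topological dual $X^*$; $T$ is an infinite index set; $f$ and $f_t$ ($t\in T$) are convex proper functions $X\to\mathbb{R}\cup\{+\infty\}$. The convention $0\times(+\infty)=0$ is used. $E:=\{x\in X:f_t(x)\le0\ \forall t\in T\}$ and $\delta_E$ is its indicator function ($0$ on $E$, $+\infty$ elsewhere). For $h:X\to\overline{\mathbb{R}}$, $h^*(x^* )=\sup_{x\in X}\{\langle x^*,x\rangle-h(x)\}$. $\mathcal{H}_1:=\{\{t\}:t\in T\}$. $(\mathrm{P})$: $\inf f(x)$ s.t. $f_t(x)\le0$, $t\in T$. $(\mathrm{D}_{\mathcal{H}_1})$: $\sup_{(t,\mu)\in T\times\mathbb{R}_+}\inf_{x\in X}\{f(x)+\mu f_t(x)\}$. The symbols $\min$, $\max$ mean that the infimum,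 supremum (in $\overline{\mathbb{R}}$) over $(t,\mu)$ is attained. *)

theory Defs
  imports "HOL-Analysis.Analysis"
begin

text \<open>Real locally convex topological vector spaces. The Hausdorff property is not part of the
  class; it is added through the sort constraint \<^class>\<open>t2_space\<close> where it is wanted.
  Convexity of \<open>V\<close> is spelled out because \<^const>\<open>convex\<close> cannot be used inside a class specification;
  see \<open>open_convex_nhds_0'\<close> below.\<close>

class locally_convex_space = real_vector + topological_ab_group_add +
  assumes tendsto_scaleR_Pair:
    "filterlim (\<lambda>p. fst p *\<^sub>R snd p) (nhds (r *\<^sub>R a)) (nhds (r::real) \<times>\<^sub>F nhds a)"
  assumes open_convex_nhds_0:
    "open U \<Longrightarrow> 0 \<in> U \<Longrightarrow> \<exists>V. open V \<and> 0 \<in> V \<and> V \<subseteq> U \<and>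
      (\<forall>x\<in>V. \<forall>y\<in>V. \<forall>u\<ge>0. \<forall>v\<ge>0. u + v = 1 \<longrightarrow> u *\<^sub>R x + v *\<^sub>R y \<in> V)"

lemma open_convex_nhds_0':
  fixes U :: "'a::locally_convex_space set"
  assumes "open U" "0 \<in> U"
  shows "\<exists>V. open V \<and> convex V \<and> 0 \<in> V \<and> V \<subseteq> U"
  using open_convex_nhds_0[OF assms] unfolding convex_def by blast

instance real_normed_vector \<subseteq> locally_convex_space
proof
  fix r :: real and a :: 'a
  have "((\<lambda>p. fst p *\<^sub>R snd p) \<longlongrightarrow> r *\<^sub>R a) (nhds (r, a))"
    by (intro tendsto_scaleR tendsto_fst[of "\<lambda>p. p" "(r, a)", simplified]
          tendsto_snd[of "\<lambda>p. p" "(r, a)", simplified] filterlim_ident)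
  then show "filterlim (\<lambda>p. fst p *\<^sub>R snd p) (nhds (r *\<^sub>R a)) (nhds r \<times>\<^sub>F nhds a)"
    by (simp add: nhds_prod)
next
  fix U :: "'a set"
  assume "open U" "0 \<in> U"
  then obtain e where "e > 0" "ball 0 e \<subseteq> U"
    by (meson open_contains_ball)
  moreover have "convex (ball (0::'a) e)"
    by (rule convex_ball)
  ultimately show "\<exists>V. open V \<and> 0 \<in> V \<and> V \<subseteq> U \<and>
      (\<forall>x\<in>V. \<forall>y\<in>V. \<forall>u\<ge>0. \<forall>v\<ge>0. u + v = 1 \<longrightarrow> u *\<^sub>R x + v *\<^sub>R y \<in> V)"
    by (intro exI[of _ "ball 0 e"] conjI) (auto simp only: convex_def open_ball centre_in_ball)
qed

definition topological_dual :: "('a::locally_convex_space \<Rightarrow> real) set" where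
  "topological_dual = {\<phi>. linear \<phi> \<and> continuous_on UNIV \<phi>}"

definition eff_dom :: "('a \<Rightarrow> ereal) \<Rightarrow> 'a set" where
  "eff_dom h = {x. h x < \<infinity>}"

definition proper :: "('a \<Rightarrow> ereal) \<Rightarrow> bool" where
  "proper h \<longleftrightarrow> (\<forall>x. h x \<noteq> -\<infinity>) \<and> eff_dom h \<noteq> {}"

text \<open>Meant for functions that avoid \<open>-\<infinity>\<close>, so that the right-hand side never has the form
  \<open>\<infinity> + (-\<infinity>)\<close>. Note that \<open>0 * \<infinity> = 0\<close> holds in \<^typ>\<open>ereal\<close>.\<close>

definition ereal_convex :: "('a::real_vector \<Rightarrow> ereal) \<Rightarrow> bool" where
  "ereal_convex h \<longleftrightarrow>
    (\<forall>x y. \<forall>u\<ge>0. \<forall>v\<ge>0. u + v = 1 \<longrightarrow> h (u *\<^sub>R x + v *\<^sub>R y) \<le> ereal u * h x + ereal v * h y)"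

definition upper_semicontinuous_on :: "'t::topological_space set \<Rightarrow> ('t \<Rightarrow> ereal) \<Rightarrow> bool" where
  "upper_semicontinuous_on T h \<longleftrightarrow> (\<forall>c. openin (top_of_set T) {t \<in> T. h t < c})"

definition delta :: "'a set \<Rightarrow> 'a \<Rightarrow> ereal" where
  "delta E x = (if x \<in> E then 0 else \<infinity>)"

definition conjugate :: "('a \<Rightarrow> ereal) \<Rightarrow> ('a \<Rightarrow> real) \<Rightarrow> ereal" where
  "conjugate h \<phi> = (SUP x. ereal (\<phi> x) - h x)"

definition feasible_set :: "'t set \<Rightarrow> ('t \<Rightarrow> 'a \<Rightarrow> ereal) \<Rightarrow> 'a set" where
  "feasible_set T g = {x. \<forall>t\<in>T. g t x \<le> 0}"

definition lagrangian :: "('a \<Rightarrow> ereal) \<Rightarrow> ('t \<Rightarrow> 'a \<Rightarrow> ereal) \<Rightarrow> 't \<times> real \<Rightarrow> 'a \<Rightarrow> ereal" where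
  "lagrangian f g = (\<lambda>(t, \<mu>) x. f x + ereal \<mu> * g t x)"

definition inf_P :: "'t set \<Rightarrow> ('a \<Rightarrow> ereal) \<Rightarrow> ('t \<Rightarrow> 'a \<Rightarrow> ereal) \<Rightarrow> ereal" where
  "inf_P T f g = (INF x\<in>feasible_set T g. f x)"

definition is_min_of :: "ereal \<Rightarrow> ('i \<Rightarrow> ereal) \<Rightarrow> 'i set \<Rightarrow> bool" where
  "is_min_of v F A \<longleftrightarrow> v = (INF i\<in>A. F i) \<and> (\<exists>i\<in>A. F i = v)"

definition is_max_of :: "ereal \<Rightarrow> ('i \<Rightarrow> ereal) \<Rightarrow> 'i set \<Rightarrow> bool" where
  "is_max_of v F A \<longleftrightarrow> v = (SUP i\<in>A. F i) \<and> (\<exists>i\<in>A. F i = v)"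

definition H1_stable_strong_duality ::
  "'t set \<Rightarrow> ('a::locally_convex_space \<Rightarrow> ereal) \<Rightarrow> ('t \<Rightarrow> 'a \<Rightarrow> ereal) \<Rightarrow> bool" where
  "H1_stable_strong_duality T f g \<longleftrightarrow>
    (\<forall>\<phi>\<in>topological_dual.
      is_min_of (conjugate (\<lambda>x. f x + delta (feasible_set T g) x) \<phi>)
        (\<lambda>p. conjugate (lagrangian f g p) \<phi>) (T \<times> {0..}))"

end

theory Submission
  imports Defs
begin

text \<open>
  Fix \<open>\<phi>\<close> in the dual and work on \<open>D = dom f\<close>, where all data are real valued. With \<open>F = f - \<phi>\<close>
  and \<open>m\<close> the infimum of \<open>F\<close> over the feasible points, attainment of the dual means that some
  \<open>(t, \<mu>)\<close> satisfies \<open>F x + \<mu> * g t x \<ge> m\<close> for all \<open>x \<in> D\<close> simultaneously. The other inequality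
  is weak duality, which also settles the case \<open>m = -\<infinity>\<close>; below \<open>m\<close> is finite.

  The Slater point gives a weaker statement, in which the multiplier may depend on \<open>x\<close> but stays in
  a compact set. Moving an infeasible \<open>x\<close> towards the Slater point until it becomes feasible shows
  that the violation of the constraints is an exact penalty (\<open>slater_exact_penalty\<close>): there is one
  constant \<open>M\<close> such that for every \<open>x\<close> the inequality holds with \<open>\<mu> \<in> {0, M}\<close> and \<open>t\<close> an index of
  largest violation, which exists because \<open>T\<close> is compact and \<open>t \<mapsto> g t x\<close> is upper semicontinuous.

  A minimax theorem over \<open>T \<times> [0, M]\<close> then makes the multiplier independent of \<open>x\<close>. The function
  \<open>(t, \<mu>) \<mapsto> F x + \<mu> * g t x\<close> need not be quasiconcave, so the classical theorem of Sion is not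
  directly applicable; but \<open>\<mu> * g t x\<close> is concave in the variables \<open>(\<mu> t, \<mu>)\<close>, and this is enough for the
  function to be concavelike in the sense of Fan (\<open>perspective_concavelike\<close>). Fan's theorem
  (\<open>minimax\<close>) reduces by compactness to finitely many \<open>x\<close>, and that case follows by induction from
  separation of convex sets in the plane.

  The second assertion is the case \<open>\<phi> = 0\<close>, since a conjugate at \<open>0\<close> is a negated infimum.
\<close>

section \<open>Minimax for convexlike-concavelike functions\<close>

text \<open>Fan's notions replace the convex combination of two points by some point of the set whose
  values are at least as good, uniformly in the other variable. Hence concavity may take place in
  other coordinates than the given ones, as it does for \<open>(t, \<mu>) \<mapsto> \<mu> * G t x\<close> below.\<close>

definition concavelike :: "'y set \<Rightarrow> 'x set \<Rightarrow> ('y \<Rightarrow> 'x \<Rightarrow> real) \<Rightarrow> bool" where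
  "concavelike Y D L \<longleftrightarrow> (\<forall>y1\<in>Y. \<forall>y2\<in>Y. \<forall>u\<ge>0. \<forall>v\<ge>0. u + v = 1 \<longrightarrow>
     (\<exists>y\<in>Y. \<forall>x\<in>D. u * L y1 x + v * L y2 x \<le> L y x))"

definition convexlike :: "'x set \<Rightarrow> 'y set \<Rightarrow> ('y \<Rightarrow> 'x \<Rightarrow> real) \<Rightarrow> bool" where
  "convexlike D Y L \<longleftrightarrow> (\<forall>x1\<in>D. \<forall>x2\<in>D. \<forall>u\<ge>0. \<forall>v\<ge>0. u + v = 1 \<longrightarrow>
     (\<exists>x\<in>D. \<forall>y\<in>Y. L y x \<le> u * L y x1 + v * L y x2))"

text \<open>The hypothesis says that the downward closure \<open>A\<close> of the values \<open>(L y x1, L y x2)\<close> misses the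
  quadrant \<open>{c<..} \<times> {c..}\<close>, and \<open>A\<close> is convex because \<open>L\<close> is concavelike. The weights are the
  normal of a separating line.\<close>

lemma two_point_alternative:
  assumes conc: "concavelike Y D L" and "Y \<noteq> {}" and x: "x1 \<in> D" "x2 \<in> D"
    and no: "\<And>y. y \<in> Y \<Longrightarrow> c \<le> L y x2 \<Longrightarrow> L y x1 \<le> c"
  obtains u v where "0 \<le> u" "0 \<le> v" "u + v = 1" "\<And>y. y \<in> Y \<Longrightarrow> u * L y x1 + v * L y x2 \<le> c"
proof -
  define A where "A = {(a, b). \<exists>y\<in>Y. a \<le> L y x1 \<and> b \<le> L y x2}"
  have "convex A"
    unfolding convex_def
  proof (intro ballI allI impI)
    fix p q and u v :: real
    assume pq: "p \<in> A" "q \<in> A" and uv: "0 \<le> u" "0 \<le> v" "u + v = 1"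
    obtain y1 where y1: "y1 \<in> Y" "fst p \<le> L y1 x1" "snd p \<le> L y1 x2"
      using pq(1) by (auto simp: A_def)
    obtain y2 where y2: "y2 \<in> Y" "fst q \<le> L y2 x1" "snd q \<le> L y2 x2"
      using pq(2) by (auto simp: A_def)
    obtain y where y: "y \<in> Y" "\<And>x. x \<in> D \<Longrightarrow> u * L y1 x + v * L y2 x \<le> L y x"
      using conc y1(1) y2(1) uv unfolding concavelike_def by meson
    have "u * fst p + v * fst q \<le> L y x1"
      by (rule order_trans[OF add_mono y(2)[OF x(1)]]) (use uv y1 y2 in \<open>auto intro: mult_left_mono\<close>)
    moreover have "u * snd p + v * snd q \<le> L y x2"
      by (rule order_trans[OF add_mono y(2)[OF x(2)]]) (use uv y1 y2 in \<open>auto intro: mult_left_mono\<close>)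
    ultimately show "u *\<^sub>R p + v *\<^sub>R q \<in> A"
      using y(1) by (auto simp: A_def case_prod_beta)
  qed
  moreover have "convex ({c<..} \<times> {c..})"
    by (intro convex_Times) auto
  moreover have "A \<noteq> {}"
    using \<open>Y \<noteq> {}\<close> by (auto simp: A_def)
  moreover have "{c<..} \<times> {c..} \<noteq> {}"
    by auto
  moreover have "A \<inter> {c<..} \<times> {c..} = {}"
    using no by (force simp: A_def)
  ultimately obtain w b where w: "w \<noteq> 0" "\<And>z. z \<in> A \<Longrightarrow> w \<bullet> z \<le> b"
      "\<And>z. z \<in> {c<..} \<times> {c..} \<Longrightarrow> b \<le> w \<bullet> z"
    using separating_hyperplane_sets[of A "{c<..} \<times> {c..}"] by blast
  obtain p q where pq: "w = (p, q)"
    by (cases w)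
  have up: "b \<le> p * s + q * r" if "s > c" "r \<ge> c" for s r
    using w(3)[of "(s, r)"] that by (simp add: pq)
  have low: "p * s + q * r \<le> b" if "y \<in> Y" "s \<le> L y x1" "r \<le> L y x2" for y s r
    using w(2)[of "(s, r)"] that by (auto simp: pq A_def)
  obtain y0 where y0: "y0 \<in> Y"
    using \<open>Y \<noteq> {}\<close> by blast
  \<comment> \<open>A negative coefficient would make the functional unbounded above on the downward closed set
    of dominated values.\<close>
  have "0 \<le> p"
  proof (rule ccontr)
    assume neg: "\<not> 0 \<le> p"
    define s where "s = min (L y0 x1) ((b - q * L y0 x2) / p - 1)"
    have "s \<le> (b - q * L y0 x2) / p - 1"
      unfolding s_def by simp
    then have "b - q * L y0 x2 < p * s"
      using neg by (simp add: field_simps)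
    moreover have "s \<le> L y0 x1"
      unfolding s_def by simp
    ultimately show False
      using low[OF y0, of s "L y0 x2"] by simp
  qed
  have "0 \<le> q"
  proof (rule ccontr)
    assume neg: "\<not> 0 \<le> q"
    define r where "r = min (L y0 x2) ((b - p * L y0 x1) / q - 1)"
    have "r \<le> (b - p * L y0 x1) / q - 1"
      unfolding r_def by simp
    then have "b - p * L y0 x1 < q * r"
      using neg by (simp add: field_simps)
    moreover have "r \<le> L y0 x2"
      unfolding r_def by simp
    ultimately show False
      using low[OF y0, of "L y0 x1" r] by simp
  qed
  have pos: "0 < p + q"
  proof -
    have "p \<noteq> 0 \<or> q \<noteq> 0"
      using w(1) by (auto simp: pq zero_prod_def)
    then show ?thesis
      using \<open>0 \<le> p\<close> \<open>0 \<le> q\<close> by linarith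
  qed
  \<comment> \<open>The corner \<open>(c, c)\<close> lies in the closure of the quadrant.\<close>
  have "b \<le> (p + q) * c"
  proof (rule field_le_epsilon)
    fix e :: real assume "e > 0"
    have "b \<le> p * (c + e / (p + q)) + q * (c + e / (p + q))"
      by (rule up) (use \<open>e > 0\<close> pos in auto)
    also have "\<dots> = (p + q) * (c + e / (p + q))"
      by (simp only: distrib_right)
    also have "\<dots> = (p + q) * c + e"
      using pos by (simp add: distrib_left)
    finally show "b \<le> (p + q) * c + e" .
  qed
  show thesis
  proof
    show "0 \<le> p / (p + q)" "0 \<le> q / (p + q)" "p / (p + q) + q / (p + q) = 1"
      using \<open>0 \<le> p\<close> \<open>0 \<le> q\<close> pos by (simp_all flip: add_divide_distrib)
    fix y assume "y \<in> Y"
    then have "p * L y x1 + q * L y x2 \<le> (p + q) * c"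
      using low[of y "L y x1" "L y x2"] \<open>b \<le> (p + q) * c\<close> by simp
    then have "(p * L y x1 + q * L y x2) / (p + q) \<le> c"
      using pos by (simp add: pos_divide_le_eq mult.commute)
    then show "p / (p + q) * L y x1 + q / (p + q) * L y x2 \<le> c"
      by (simp add: add_divide_distrib)
  qed
qed

text \<open>Induction on the number of points uses separation in dimension two only. For a new point \<open>z\<close>,
  restrict to the \<open>y\<close> with \<open>c \<le> L y z\<close>, which again form a set on which \<open>L\<close> is concavelike. There
  the old points alone obstruct, so by induction one point \<open>x'\<close> replaces them all; it remains to
  combine \<open>x'\<close> and \<open>z\<close> by the two-point alternative and convexlikeness.\<close>

lemma finite_alternative:
  assumes "finite X" "X \<subseteq> D" "D \<noteq> {}"
    and "concavelike Y D L" "convexlike D Y L"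
    and "\<And>y. y \<in> Y \<Longrightarrow> \<exists>x\<in>X. L y x < c"
  shows "\<exists>x\<in>D. \<forall>y\<in>Y. L y x \<le> c"
  using assms
proof (induction X arbitrary: Y rule: finite_induct)
  case empty
  then show ?case by blast
next
  case (insert z X)
  show ?case
  proof (cases "Y = {}")
    case True
    then show ?thesis using insert.prems by blast
  next
    case False
    define Y' where "Y' = {y \<in> Y. c \<le> L y z}"
    have z: "z \<in> D" using insert.prems by blast
    have "concavelike Y' D L"
      unfolding concavelike_def
    proof (intro ballI allI impI)
      fix y1 y2 and u v :: real
      assume y: "y1 \<in> Y'" "y2 \<in> Y'" and uv: "0 \<le> u" "0 \<le> v" "u + v = 1"
      then obtain y where "y \<in> Y" and le: "\<And>x. x \<in> D \<Longrightarrow> u * L y1 x + v * L y2 x \<le> L y x"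
        using insert.prems(3) unfolding concavelike_def Y'_def by blast
      have "c = u * c + v * c"
        using uv(3) by (simp flip: distrib_right)
      also have "\<dots> \<le> u * L y1 z + v * L y2 z"
        using y uv by (intro add_mono mult_left_mono) (auto simp: Y'_def)
      also have "\<dots> \<le> L y z"
        by (rule le[OF z])
      finally have "c \<le> L y z" .
      then show "\<exists>y\<in>Y'. \<forall>x\<in>D. u * L y1 x + v * L y2 x \<le> L y x"
        using \<open>y \<in> Y\<close> le by (auto simp: Y'_def)
    qed
    moreover have "convexlike D Y' L"
      using insert.prems(4) unfolding convexlike_def Y'_def by blast
    moreover have "\<exists>x\<in>X. L y x < c" if "y \<in> Y'" for y
      using insert.prems(5)[of y] that by (auto simp: Y'_def)
    ultimately obtain x' where x': "x' \<in> D" "\<And>y. y \<in> Y' \<Longrightarrow> L y x' \<le> c"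
      using insert.IH[of Y'] insert.prems by blast
    obtain u v where uv: "0 \<le> u" "0 \<le> v" "u + v = 1"
        "\<And>y. y \<in> Y \<Longrightarrow> u * L y x' + v * L y z \<le> c"
      using two_point_alternative[OF insert.prems(3) False x'(1) z, of c] x'(2)
      unfolding Y'_def by blast
    obtain x where x: "x \<in> D" "\<And>y. y \<in> Y \<Longrightarrow> L y x \<le> u * L y x' + v * L y z"
      using insert.prems(4) x'(1) z uv(1-3) unfolding convexlike_def by meson
    show ?thesis
      using x uv(4) by (meson order_trans)
  qed
qed

text \<open>Fan's minimax theorem, in the form ``if every \<open>x\<close> has a good \<open>y\<close>, then some \<open>y\<close> is good for
  every \<open>x\<close>''. Otherwise the open sets \<open>{y. L y x < c}\<close> with \<open>c < m\<close> cover \<open>Y\<close>. The thresholds are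
  taken strictly below \<open>m\<close> because the largest of the finitely many that remain then leaves a gap,
  so the weak inequality of the finite alternative is already contradictory.\<close>

lemma minimax:
  fixes Y :: "'y::topological_space set"
  assumes "compact Y" "D \<noteq> {}"
    and usc: "\<And>x c. x \<in> D \<Longrightarrow> openin (top_of_set Y) {y \<in> Y. L y x < c}"
    and conc: "concavelike Y D L" and conv: "convexlike D Y L"
    and sup: "\<And>x. x \<in> D \<Longrightarrow> \<exists>y\<in>Y. m \<le> L y x"
  shows "\<exists>y\<in>Y. \<forall>x\<in>D. m \<le> L y x"
proof (rule ccontr)
  assume contr: "\<not> ?thesis"
  define O' where "O' = (\<lambda>(x, c). {y \<in> Y. L y x < c})"
  define I where "I = D \<times> {..<m}"
  have "Y \<subseteq> \<Union>(O' ` I)"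
  proof
    fix y assume y: "y \<in> Y"
    then obtain x where "x \<in> D" "L y x < m"
      using contr by (auto simp: not_le)
    moreover obtain c where "L y x < c" "c < m"
      using dense \<open>L y x < m\<close> by blast
    ultimately have "(x, c) \<in> I" "y \<in> O' (x, c)"
      using y by (auto simp: O'_def I_def)
    then show "y \<in> \<Union>(O' ` I)" by blast
  qed
  moreover have "\<forall>U\<in>O' ` I. openin (top_of_set Y) U"
    using usc by (auto simp: O'_def I_def)
  ultimately obtain \<U> where "\<U> \<subseteq> O' ` I" "finite \<U>" "Y \<subseteq> \<Union>\<U>"
    using \<open>compact Y\<close> unfolding compact_eq_openin_cover by meson
  then obtain J where J: "J \<subseteq> I" "finite J" "Y \<subseteq> \<Union>(O' ` J)"
    by (metis finite_subset_image)
  \<comment> \<open>The extra element \<open>m - 1\<close> covers the case that \<open>J\<close> is empty.\<close>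
  define c where "c = Max (insert (m - 1) (snd ` J))"
  have "c < m"
    using J unfolding c_def I_def by (subst Max_less_iff) auto
  have c: "s \<le> c" if "(x, s) \<in> J" for x s
    unfolding c_def using J(2) that by (intro Max_ge) force+
  have "\<exists>x\<in>fst ` J. L y x < c" if y: "y \<in> Y" for y
  proof -
    obtain x s where xs: "(x, s) \<in> J" "y \<in> O' (x, s)"
      using J(3) y by fast
    then have "L y x < s"
      by (simp add: O'_def)
    with xs(1) show ?thesis
      using c[of x s] by force
  qed
  moreover have "finite (fst ` J)" "fst ` J \<subseteq> D"
    using J by (auto simp: I_def)
  ultimately obtain x where "x \<in> D" "\<forall>y\<in>Y. L y x \<le> c"
    using finite_alternative[OF _ _ \<open>D \<noteq> {}\<close> conc conv, of "fst ` J" c] by blast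
  with sup[of x] \<open>c < m\<close> show False
    by fastforce
qed

section \<open>Lagrange multipliers under the Slater condition\<close>

lemma usc_attains_sup:
  fixes h :: "'t::topological_space \<Rightarrow> real"
  assumes "compact T" "T \<noteq> {}" and usc: "\<And>c. openin (top_of_set T) {t \<in> T. h t < c}"
  shows "\<exists>s\<in>T. \<forall>t\<in>T. h t \<le> h s"
proof (rule ccontr)
  assume contr: "\<not> ?thesis"
  define B where "B s = {t \<in> T. h t < h s}" for s
  have "T \<subseteq> \<Union>(B ` T)"
    using contr by (force simp: B_def not_le)
  moreover have "\<forall>U\<in>B ` T. openin (top_of_set T) U"
    using usc by (simp add: B_def)
  ultimately obtain \<U> where "\<U> \<subseteq> B ` T" "finite \<U>" "T \<subseteq> \<Union>\<U>"
    using \<open>compact T\<close> unfolding compact_eq_openin_cover by meson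
  then obtain S where S: "S \<subseteq> T" "finite S" "T \<subseteq> \<Union>(B ` S)"
    by (metis finite_subset_image)
  with \<open>T \<noteq> {}\<close> have "S \<noteq> {}" by blast
  then have "Max (h ` S) \<in> h ` S"
    using S(2) by simp
  then obtain s where s: "s \<in> S" "h s = Max (h ` S)"
    by auto
  obtain s' where "s' \<in> S" "h s < h s'"
    using S s(1) unfolding B_def by blast
  with s S(2) show False
    by (metis Max_ge finite_imageI image_eqI not_le)
qed

text \<open>The term \<open>\<mu> * G t x\<close> is the perspective of a concave function of \<open>t\<close>: combining \<open>(t1, \<mu>1)\<close> and
  \<open>(t2, \<mu>2)\<close>, the multipliers are averaged with the given weights, but the indices with weights
  proportional to the shares of \<open>\<mu>1\<close> and \<open>\<mu>2\<close> in the average \<open>\<mu>\<close>. When \<open>\<mu> = 0\<close> both terms vanish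
  and any index works. The choice does not depend on \<open>x\<close>.\<close>

lemma perspective_concavelike:
  fixes T :: "'t::real_vector set" and D :: "'x set"
  assumes "convex T" and conc: "\<And>x. x \<in> D \<Longrightarrow> concave_on T (\<lambda>t. G t x)"
  shows "concavelike (T \<times> {0..M}) D (\<lambda>p x. F x + snd p * G (fst p) x)"
  unfolding concavelike_def
proof (intro ballI allI impI)
  fix p q and u v :: real
  assume pq: "p \<in> T \<times> {0..M}" "q \<in> T \<times> {0..M}" and uv: "0 \<le> u" "0 \<le> v" "u + v = 1"
  define \<mu> where "\<mu> = u * snd p + v * snd q"
  have "0 \<le> u * snd p" "0 \<le> v * snd q"
    using pq uv by auto
  then have "0 \<le> \<mu>" unfolding \<mu>_def by simp
  have "\<mu> \<le> M"
    unfolding \<mu>_def by (rule convex_bound_le) (use pq uv in auto)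
  have aff: "u * (F x + a) + v * (F x + b) = F x + (u * a + v * b)" for x a b
  proof -
    have "u * (F x + a) + v * (F x + b) = (u + v) * F x + (u * a + v * b)"
      by (simp only: algebra_simps)
    then show ?thesis using uv(3) by simp
  qed
  have "\<exists>t\<in>T. \<forall>x\<in>D. u * (snd p * G (fst p) x) + v * (snd q * G (fst q) x) \<le> \<mu> * G t x"
  proof (cases "\<mu> = 0")
    case True
    then have "u * snd p = 0" "v * snd q = 0"
      using \<open>0 \<le> u * snd p\<close> \<open>0 \<le> v * snd q\<close> unfolding \<mu>_def by linarith+
    then have "u * (snd p * G (fst p) x) + v * (snd q * G (fst q) x) = 0" for x
      by auto
    with True pq show ?thesis
      by (intro bexI[of _ "fst p"]) auto
  next
    case False
    with \<open>0 \<le> \<mu>\<close> have "0 < \<mu>" by simp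
    define r s where "r = u * snd p / \<mu>" and "s = v * snd q / \<mu>"
    have rs: "0 \<le> r" "0 \<le> s" "r + s = 1"
      using \<open>0 < \<mu>\<close> \<open>0 \<le> u * snd p\<close> \<open>0 \<le> v * snd q\<close>
      by (auto simp: r_def s_def \<mu>_def simp flip: add_divide_distrib)
    have mu: "\<mu> * r = u * snd p" "\<mu> * s = v * snd q"
      using \<open>0 < \<mu>\<close> by (auto simp: r_def s_def)
    have T: "fst p \<in> T" "fst q \<in> T" using pq by auto
    define t where "t = r *\<^sub>R fst p + s *\<^sub>R fst q"
    have "t \<in> T"
      unfolding t_def by (rule convexD[OF \<open>convex T\<close> T rs])
    moreover have "u * (snd p * G (fst p) x) + v * (snd q * G (fst q) x) \<le> \<mu> * G t x"
      if "x \<in> D" for x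
    proof -
      have "r * G (fst p) x + s * G (fst q) x \<le> G t x"
        using conc[OF that] T rs unfolding concave_on_iff t_def by blast
      then have "\<mu> * (r * G (fst p) x + s * G (fst q) x) \<le> \<mu> * G t x"
        using \<open>0 < \<mu>\<close> by simp
      then show ?thesis
        by (simp add: distrib_left mu mult.assoc[symmetric])
    qed
    ultimately show ?thesis by blast
  qed
  then obtain t where "t \<in> T"
    "\<And>x. x \<in> D \<Longrightarrow> u * (snd p * G (fst p) x) + v * (snd q * G (fst q) x) \<le> \<mu> * G t x"
    by blast
  then show "\<exists>y\<in>T \<times> {0..M}. \<forall>x\<in>D. u * (F x + snd p * G (fst p) x) + v * (F x + snd q * G (fst q) x)
      \<le> F x + snd y * G (fst y) x"
    using \<open>0 \<le> \<mu>\<close> \<open>\<mu> \<le> M\<close> by (intro bexI[of _ "(t, \<mu>)"]) (auto simp: aff)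
qed

text \<open>Nonnegativity of the multiplier keeps the direction of upper semicontinuity under the product,
  and a finite bound \<open>d\<close> of \<open>h\<close> near a point is multiplied by a continuous factor. At multiplier
  \<open>0\<close> this uses that \<open>h\<close> is locally bounded above.\<close>

lemma scaled_usc:
  fixes h :: "'t::topological_space \<Rightarrow> real" and a c M :: real
  assumes usc: "\<And>c. openin (top_of_set T) {t \<in> T. h t < c}"
  shows "openin (top_of_set (T \<times> {0..M})) {p \<in> T \<times> {0..M}. a + snd p * h (fst p) < c}"
proof (subst openin_subopen, intro ballI)
  fix p assume "p \<in> {p \<in> T \<times> {0..M}. a + snd p * h (fst p) < c}"
  then obtain t \<mu> where p: "p = (t, \<mu>)" "t \<in> T" "\<mu> \<in> {0..M}" "a + \<mu> * h t < c"
    by force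
  obtain d where d: "h t < d" "a + \<mu> * d < c"
  proof (cases "\<mu> = 0")
    case True
    then show thesis using that[of "h t + 1"] p by simp
  next
    case False
    then have "\<mu> > 0" using p by simp
    then have "h t < (c - a) / \<mu>"
      using p(4) by (simp add: field_simps)
    then obtain d where "h t < d" "d < (c - a) / \<mu>"
      using dense by blast
    then show thesis using that[of d] \<open>\<mu> > 0\<close> by (simp add: field_simps)
  qed
  define U where "U = {t \<in> T. h t < d} \<times> {\<nu> \<in> {0..M}. a + \<nu> * d < c}"
  have "open {\<nu>. a + \<nu> * d < c}"
    by (intro open_Collect_less continuous_intros)
  then have "openin (top_of_set {0..M}) {\<nu> \<in> {0..M}. a + \<nu> * d < c}"
    unfolding openin_open by blast
  then have "openin (top_of_set (T \<times> {0..M})) U"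
    unfolding U_def by (intro openin_Times usc)
  moreover have "p \<in> U"
    using p d by (auto simp: U_def)
  moreover have "U \<subseteq> {p \<in> T \<times> {0..M}. a + snd p * h (fst p) < c}"
  proof
    fix q assume "q \<in> U"
    then have q: "fst q \<in> T" "h (fst q) < d" "snd q \<in> {0..M}" "a + snd q * d < c"
      by (auto simp: U_def)
    then have "snd q * h (fst q) \<le> snd q * d"
      by (intro mult_left_mono) auto
    with q show "q \<in> {p \<in> T \<times> {0..M}. a + snd p * h (fst p) < c}"
      by (cases q) auto
  qed
  ultimately show "\<exists>U. openin (top_of_set (T \<times> {0..M})) U \<and> p \<in> U \<and>
      U \<subseteq> {p \<in> T \<times> {0..M}. a + snd p * h (fst p) < c}"
    by blast
qed

text \<open>The point \<open>z\<close> of the segment from \<open>x\<close> to the Slater point that balances the violation \<open>\<gamma>\<close>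
  against the slack \<open>\<alpha>\<close> is feasible, so \<open>m \<le> F z\<close>. Convexity of \<open>F\<close> along the segment turns this
  into a lower bound at \<open>x\<close> whose penalty coefficient \<open>(F xb - m) / \<alpha>\<close> is independent of \<open>x\<close>.\<close>

lemma slater_exact_penalty:
  fixes F :: "'x::real_vector \<Rightarrow> real"
  assumes F: "convex_on D F" and G: "\<And>t. t \<in> T \<Longrightarrow> convex_on D (G t)"
    and xb: "xb \<in> D" "\<And>t. t \<in> T \<Longrightarrow> G t xb \<le> - \<alpha>" "0 < \<alpha>"
    and m: "\<And>x. x \<in> D \<Longrightarrow> (\<And>t. t \<in> T \<Longrightarrow> G t x \<le> 0) \<Longrightarrow> m \<le> F x"
    and x: "x \<in> D" "0 < \<gamma>" "\<And>t. t \<in> T \<Longrightarrow> G t x \<le> \<gamma>"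
  shows "m \<le> F x + (F xb - m) / \<alpha> * \<gamma>"
proof -
  define u v where "u = \<gamma> / (\<gamma> + \<alpha>)" and "v = \<alpha> / (\<gamma> + \<alpha>)"
  have uv: "0 \<le> u" "0 \<le> v" "u + v = 1"
    using x(2) xb(3) by (auto simp: u_def v_def simp flip: add_divide_distrib)
  define z where "z = u *\<^sub>R xb + v *\<^sub>R x"
  have "z \<in> D"
    unfolding z_def using F xb(1) x(1) uv by (auto simp: convex_on_def intro: convexD)
  moreover have "G t z \<le> 0" if t: "t \<in> T" for t
  proof -
    have "G t z \<le> u * G t xb + v * G t x"
      unfolding z_def using G[OF t] xb(1) x(1) uv by (auto simp: convex_on_def)
    also have "\<dots> \<le> u * (- \<alpha>) + v * \<gamma>"
      using uv xb(2)[OF t] x(3)[OF t] by (intro add_mono mult_left_mono)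
    also have "\<dots> = 0"
      by (simp add: u_def v_def)
    finally show ?thesis .
  qed
  ultimately have "m \<le> F z"
    by (rule m)
  also have "F z \<le> u * F xb + v * F x"
    unfolding z_def using F xb(1) x(1) uv by (auto simp: convex_on_def)
  also have "\<dots> = (\<gamma> * F xb + \<alpha> * F x) / (\<gamma> + \<alpha>)"
    by (simp add: u_def v_def add_divide_distrib)
  finally have "m * (\<gamma> + \<alpha>) \<le> \<gamma> * F xb + \<alpha> * F x"
    using x(2) xb(3) by (simp add: pos_le_divide_eq)
  then show ?thesis
    using xb(3) by (simp add: field_simps)
qed

text \<open>The exact penalty provides a multiplier in \<open>T \<times> {0..M}\<close> for each \<open>x\<close> separately; the minimax
  theorem provides a common one.\<close>

theorem slater_multiplier:
  fixes F :: "'x::real_vector \<Rightarrow> real"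
    and T :: "'t::{real_vector, topological_space} set"
  assumes F: "convex_on D F" and G: "\<And>t. t \<in> T \<Longrightarrow> convex_on D (G t)"
    and T: "convex T" "compact T" "T \<noteq> {}"
    and conc: "\<And>x. x \<in> D \<Longrightarrow> concave_on T (\<lambda>t. G t x)"
    and usc: "\<And>x c. x \<in> D \<Longrightarrow> openin (top_of_set T) {t \<in> T. G t x < c}"
    and slater: "xb \<in> D" "\<And>t. t \<in> T \<Longrightarrow> G t xb < 0"
    and m: "\<And>x. x \<in> D \<Longrightarrow> (\<And>t. t \<in> T \<Longrightarrow> G t x \<le> 0) \<Longrightarrow> m \<le> F x"
  shows "\<exists>t\<in>T. \<exists>\<mu>\<ge>0. \<forall>x\<in>D. m \<le> F x + \<mu> * G t x"
proof -
  obtain s where s: "s \<in> T" "\<And>t. t \<in> T \<Longrightarrow> G t xb \<le> G s xb"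
    using usc_attains_sup[OF T(2,3) usc[OF slater(1)]] by blast
  define \<alpha> where "\<alpha> = - G s xb"
  have "0 < \<alpha>"
    using slater(2)[OF s(1)] by (simp add: \<alpha>_def)
  define M where "M = (F xb - m) / \<alpha>"
  have "m \<le> F xb"
    using slater by (intro m) (auto intro: less_imp_le)
  then have "0 \<le> M"
    using \<open>0 < \<alpha>\<close> by (simp add: M_def)
  define L where "L = (\<lambda>p x. F x + snd p * G (fst p) x)"
  have "\<exists>p\<in>T \<times> {0..M}. m \<le> L p x" if x: "x \<in> D" for x
  proof -
    obtain t where t: "t \<in> T" "\<And>t'. t' \<in> T \<Longrightarrow> G t' x \<le> G t x"
      using usc_attains_sup[OF T(2,3) usc[OF x]] by blast
    show ?thesis
    proof (cases "G t x \<le> 0")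
      case True
      then have "m \<le> F x"
        using t by (intro m x) (meson order_trans)
      then show ?thesis
        using t(1) \<open>0 \<le> M\<close> by (intro bexI[of _ "(t, 0)"]) (auto simp: L_def)
    next
      case False
      then have "m \<le> F x + M * G t x"
        unfolding M_def
        by (intro slater_exact_penalty[OF F G slater(1) _ \<open>0 < \<alpha>\<close> m x])
          (use s t in \<open>auto simp: \<alpha>_def\<close>)
      then show ?thesis
        using t(1) \<open>0 \<le> M\<close> by (intro bexI[of _ "(t, M)"]) (auto simp: L_def)
    qed
  qed
  moreover have "compact (T \<times> {0..M})"
    using T(2) by (intro compact_Times) auto
  moreover have "D \<noteq> {}"
    using slater(1) by blast
  moreover have "openin (top_of_set (T \<times> {0..M})) {p \<in> T \<times> {0..M}. L p x < c}" if "x \<in> D" for x c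
    unfolding L_def by (rule scaled_usc[OF usc[OF that]])
  moreover have "concavelike (T \<times> {0..M}) D L"
    unfolding L_def by (rule perspective_concavelike[OF T(1) conc])
  moreover have "convexlike D (T \<times> {0..M}) L"
    unfolding convexlike_def
  proof (intro ballI allI impI)
    fix x1 x2 and u v :: real
    assume x: "x1 \<in> D" "x2 \<in> D" and uv: "0 \<le> u" "0 \<le> v" "u + v = 1"
    have "L p (u *\<^sub>R x1 + v *\<^sub>R x2) \<le> u * L p x1 + v * L p x2" if p: "p \<in> T \<times> {0..M}" for p
    proof -
      have "F (u *\<^sub>R x1 + v *\<^sub>R x2) \<le> u * F x1 + v * F x2"
        using F x uv by (auto simp: convex_on_def)
      moreover have "G (fst p) (u *\<^sub>R x1 + v *\<^sub>R x2) \<le> u * G (fst p) x1 + v * G (fst p) x2"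
        using G[of "fst p"] p x uv by (auto simp: convex_on_def)
      then have "snd p * G (fst p) (u *\<^sub>R x1 + v *\<^sub>R x2)
          \<le> snd p * (u * G (fst p) x1 + v * G (fst p) x2)"
        using p by (intro mult_left_mono) auto
      ultimately show ?thesis
        by (simp add: L_def algebra_simps)
    qed
    moreover have "u *\<^sub>R x1 + v *\<^sub>R x2 \<in> D"
      using F x uv by (auto simp: convex_on_def intro: convexD)
    ultimately show "\<exists>x\<in>D. \<forall>p\<in>T \<times> {0..M}. L p x \<le> u * L p x1 + v * L p x2"
      by blast
  qed
  ultimately obtain p where "p \<in> T \<times> {0..M}" "\<forall>x\<in>D. m \<le> L p x"
    using minimax[of "T \<times> {0..M}" D L m] by blast
  then show ?thesis
    by (intro bexI[of _ "fst p"] exI[of _ "snd p"]) (auto simp: L_def)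
qed

section \<open>Extended-real-valued data\<close>

lemma convex_on_real_of_ereal:
  assumes h: "ereal_convex h" and fin: "\<And>x. x \<in> D \<Longrightarrow> \<bar>h x\<bar> \<noteq> \<infinity>" and "convex D"
  shows "convex_on D (\<lambda>x. real_of_ereal (h x))"
  unfolding convex_on_def
proof (intro conjI ballI allI impI)
  fix x y and u v :: real
  assume xy: "x \<in> D" "y \<in> D" and uv: "0 \<le> u" "0 \<le> v" "u + v = 1"
  have "u *\<^sub>R x + v *\<^sub>R y \<in> D"
    using \<open>convex D\<close> xy uv by (rule convexD)
  then obtain a b c where "h x = ereal a" "h y = ereal b" "h (u *\<^sub>R x + v *\<^sub>R y) = ereal c"
    using fin xy by (metis ereal_real')
  moreover have "h (u *\<^sub>R x + v *\<^sub>R y) \<le> ereal u * h x + ereal v * h y"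
    using h uv unfolding ereal_convex_def by blast
  ultimately show "real_of_ereal (h (u *\<^sub>R x + v *\<^sub>R y)) \<le> u * real_of_ereal (h x) + v * real_of_ereal (h y)"
    by simp
qed fact

lemma convex_eff_dom:
  assumes "ereal_convex h"
  shows "convex (eff_dom h)"
  unfolding convex_def
proof (intro ballI allI impI)
  fix x y and u v :: real
  assume xy: "x \<in> eff_dom h" "y \<in> eff_dom h" and uv: "0 \<le> u" "0 \<le> v" "u + v = 1"
  have "h (u *\<^sub>R x + v *\<^sub>R y) \<le> ereal u * h x + ereal v * h y"
    using assms uv unfolding ereal_convex_def by blast
  also have "\<dots> < \<infinity>"
    using xy uv(1,2) by (cases "h x"; cases "h y") (auto simp: eff_dom_def)
  finally show "u *\<^sub>R x + v *\<^sub>R y \<in> eff_dom h"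
    by (simp add: eff_dom_def)
qed

lemma conjugate_zero: "conjugate h (\<lambda>_. 0) = - (INF x. h x)"
  unfolding conjugate_def by (simp add: ereal_SUP_uminus_eq zero_ereal_def[symmetric])

lemma inf_P_eq: "inf_P T f g = (INF x. f x + delta (feasible_set T g) x)"
  unfolding inf_P_def
proof (rule antisym)
  show "(INF x\<in>feasible_set T g. f x) \<le> (INF x. f x + delta (feasible_set T g) x)"
    by (rule INF_greatest) (auto simp: delta_def intro: INF_lower)
  show "(INF x. f x + delta (feasible_set T g) x) \<le> (INF x\<in>feasible_set T g. f x)"
  proof (rule INF_greatest)
    fix x assume "x \<in> feasible_set T g"
    then show "(INF x. f x + delta (feasible_set T g) x) \<le> f x"
      by (intro INF_lower2[of x]) (auto simp: delta_def)
  qed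
qed

text \<open>On the feasible set a nonnegative multiple of a constraint is at most \<open>0\<close>, so the indicator
  function dominates every penalty term.\<close>

lemma conjugate_weak_duality:
  assumes "t \<in> T" "0 \<le> \<mu>"
  shows "conjugate (\<lambda>x. f x + delta (feasible_set T g) x) \<phi> \<le> conjugate (lagrangian f g (t, \<mu>)) \<phi>"
  unfolding conjugate_def
proof (rule SUP_mono')
  fix x
  have "ereal \<mu> * g t x \<le> delta (feasible_set T g) x"
    using assms by (auto simp: delta_def feasible_set_def ereal_mult_le_0_iff)
  then show "ereal (\<phi> x) - (f x + delta (feasible_set T g) x) \<le> ereal (\<phi> x) - lagrangian f g (t, \<mu>) x"
    unfolding lagrangian_def by (auto intro!: ereal_minus_mono add_left_mono)
qed

theorem theorem5p3:
  fixes f :: "'a::{locally_convex_space, t2_space} \<Rightarrow> ereal"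
    and g :: "'t::locally_convex_space \<Rightarrow> 'a \<Rightarrow> ereal"
    and T :: "'t set"
  assumes "infinite T"
    and "proper f" and "ereal_convex f"
    and "\<And>t. t \<in> T \<Longrightarrow> proper (g t)" and "\<And>t. t \<in> T \<Longrightarrow> ereal_convex (g t)"
    and a: "eff_dom f \<subseteq> (\<Inter>t\<in>T. eff_dom (g t))"
    and b: "convex T" "compact T"
    and c: "\<And>x. x \<in> (\<Inter>t\<in>T. eff_dom (g t)) \<Longrightarrow>
              concave_on T (\<lambda>t. real_of_ereal (g t x)) \<and> upper_semicontinuous_on T (\<lambda>t. g t x)"
    and d: "\<exists>x\<in>eff_dom f. \<forall>t\<in>T. g t x < 0"
  shows "H1_stable_strong_duality T f g \<and>
    -\<infinity> \<le> inf_P T f g \<and>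
    is_max_of (inf_P T f g) (\<lambda>p. INF x. lagrangian f g p x) (T \<times> {0..}) \<and>
    inf_P T f g < \<infinity>"
proof -
  define D where "D = eff_dom f"
  define fr where "fr x = real_of_ereal (f x)" for x
  define G where "G t x = real_of_ereal (g t x)" for t x
  let ?h = "\<lambda>x. f x + delta (feasible_set T g) x"
  have f: "f x = ereal (fr x)" if "x \<in> D" for x
    using that \<open>proper f\<close> by (cases "f x") (auto simp: D_def eff_dom_def fr_def proper_def)
  have f_inf: "f x = \<infinity>" if "x \<notin> D" for x
    using that by (auto simp: D_def eff_dom_def)
  have g_minf: "g t x \<noteq> -\<infinity>" if "t \<in> T" for t x
    using assms(4)[OF that] by (auto simp: proper_def)
  have g: "g t x = ereal (G t x)" if "x \<in> D" "t \<in> T" for t x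
    using that a g_minf[OF that(2), of x]
    by (cases "g t x") (auto simp: D_def eff_dom_def G_def)
  have "convex D"
    unfolding D_def by (rule convex_eff_dom) fact
  have fconv: "convex_on D fr"
    unfolding fr_def by (rule convex_on_real_of_ereal) (use f \<open>convex D\<close> assms(3) in auto)
  have Gconv: "convex_on D (G t)" if "t \<in> T" for t
    unfolding G_def
    by (rule convex_on_real_of_ereal) (use g that \<open>convex D\<close> assms(5) in auto)
  have conc: "concave_on T (\<lambda>t. G t x)" if "x \<in> D" for x
    using c[of x] a that unfolding G_def D_def by blast
  have usc: "openin (top_of_set T) {t \<in> T. G t x < s}" if "x \<in> D" for x s
  proof -
    have "openin (top_of_set T) {t \<in> T. g t x < ereal s}"
      using c[of x] a that unfolding upper_semicontinuous_on_def D_def by blast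
    also have "{t \<in> T. g t x < ereal s} = {t \<in> T. G t x < s}"
      using g[OF that] by auto
    finally show ?thesis .
  qed
  obtain xb where xb: "xb \<in> D" "\<And>t. t \<in> T \<Longrightarrow> g t xb < 0"
    using d unfolding D_def by blast
  have Gxb: "G t xb < 0" if "t \<in> T" for t
    using xb(2)[OF that] g[OF xb(1) that] by simp
  have "T \<noteq> {}"
    using \<open>infinite T\<close> by auto
  have xbE: "xb \<in> feasible_set T g"
    using xb(2) by (auto simp: feasible_set_def intro: less_imp_le)

  have attained: "\<exists>p\<in>T \<times> {0..}. conjugate (lagrangian f g p) \<phi> = conjugate ?h \<phi>"
    if \<phi>: "\<phi> \<in> topological_dual" for \<phi>
  proof (cases "conjugate ?h \<phi>")
    case PInf
    \<comment> \<open>By weak duality every multiplier attains the value \<open>\<infinity>\<close>.\<close>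
    obtain t where "t \<in> T" using \<open>T \<noteq> {}\<close> by blast
    then show ?thesis
      using conjugate_weak_duality[of t T 0 f g \<phi>] PInf by (intro bexI[of _ "(t, 0)"]) auto
  next
    case MInf
    \<comment> \<open>Impossible: the Slater point is feasible and \<open>f\<close> is finite there.\<close>
    have "ereal (\<phi> xb) - ?h xb \<le> conjugate ?h \<phi>"
      unfolding conjugate_def by (rule SUP_upper) simp
    then show ?thesis
      using MInf f[OF xb(1)] xbE by (simp add: delta_def)
  next
    case (real v)
    define F where "F x = fr x - \<phi> x" for x
    have lin: "linear \<phi>"
      using \<phi> by (simp add: topological_dual_def)
    have Fconv: "convex_on D F"
      using fconv unfolding convex_on_def F_def
      by (auto simp: linear_add[OF lin] linear_scale[OF lin] algebra_simps)
    have Fbound: "- v \<le> F x" if "x \<in> D" "\<And>t. t \<in> T \<Longrightarrow> G t x \<le> 0" for x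
    proof -
      have "x \<in> feasible_set T g"
        using that g by (auto simp: feasible_set_def)
      moreover have "ereal (\<phi> x) - ?h x \<le> ereal v"
        unfolding real[symmetric] conjugate_def by (rule SUP_upper) simp
      ultimately show ?thesis
        using f[OF that(1)] by (simp add: delta_def F_def)
    qed
    obtain t \<mu> where t: "t \<in> T" "0 \<le> \<mu>" "\<And>x. x \<in> D \<Longrightarrow> - v \<le> F x + \<mu> * G t x"
      using slater_multiplier[where F = F and G = G and D = D and xb = xb and m = "- v",
        OF Fconv Gconv b \<open>T \<noteq> {}\<close> conc usc xb(1) Gxb Fbound]
      by blast
    have "conjugate (lagrangian f g (t, \<mu>)) \<phi> \<le> ereal v"
      unfolding conjugate_def
    proof (rule SUP_least)
      fix x
      show "ereal (\<phi> x) - lagrangian f g (t, \<mu>) x \<le> ereal v"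
      proof (cases "x \<in> D")
        case True
        then show ?thesis
          using t(3)[OF True] f[OF True] g[OF True t(1)] by (simp add: lagrangian_def F_def)
      next
        case False
        have "ereal \<mu> * g t x \<noteq> -\<infinity>"
          using g_minf[OF t(1), of x] t(2) by (cases "g t x") auto
        then show ?thesis
          using f_inf[OF False] by (simp add: lagrangian_def)
      qed
    qed
    moreover have "ereal v \<le> conjugate (lagrangian f g (t, \<mu>)) \<phi>"
      unfolding real[symmetric] by (rule conjugate_weak_duality[OF t(1,2)])
    ultimately show ?thesis
      using t(1,2) real by (intro bexI[of _ "(t, \<mu>)"]) auto
  qed
  have stable: "H1_stable_strong_duality T f g"
    unfolding H1_stable_strong_duality_def is_min_of_def
  proof (intro ballI conjI)
    fix \<phi> :: "'a \<Rightarrow> real" assume \<phi>: "\<phi> \<in> topological_dual"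
    show "\<exists>p\<in>T \<times> {0..}. conjugate (lagrangian f g p) \<phi> = conjugate ?h \<phi>"
      by (rule attained[OF \<phi>])
    then obtain p where p: "p \<in> T \<times> {0..}" "conjugate (lagrangian f g p) \<phi> = conjugate ?h \<phi>"
      by blast
    show "conjugate ?h \<phi> = (INF p\<in>T \<times> {0..}. conjugate (lagrangian f g p) \<phi>)"
    proof (rule antisym)
      show "conjugate ?h \<phi> \<le> (INF p\<in>T \<times> {0..}. conjugate (lagrangian f g p) \<phi>)"
        by (rule INF_greatest) (auto simp: conjugate_weak_duality)
      show "(INF p\<in>T \<times> {0..}. conjugate (lagrangian f g p) \<phi>) \<le> conjugate ?h \<phi>"
        unfolding p(2)[symmetric] by (rule INF_lower[OF p(1)])
    qed
  qed
  have "(\<lambda>_. 0) \<in> (topological_dual :: ('a \<Rightarrow> real) set)"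
    by (simp add: topological_dual_def linear_zero)
  then have "is_min_of (conjugate ?h (\<lambda>_. 0)) (\<lambda>p. conjugate (lagrangian f g p) (\<lambda>_. 0)) (T \<times> {0..})"
    by (rule bspec[OF stable[unfolded H1_stable_strong_duality_def]])
  then have "is_min_of (- inf_P T f g) (\<lambda>p. - (INF x. lagrangian f g p x)) (T \<times> {0..})"
    by (simp only: conjugate_zero inf_P_eq)
  then have "is_max_of (inf_P T f g) (\<lambda>p. INF x. lagrangian f g p x) (T \<times> {0..})"
    unfolding is_min_of_def is_max_of_def ereal_INF_uminus_eq ereal_uminus_eq_iff .
  moreover have "inf_P T f g < \<infinity>"
  proof (rule le_less_trans)
    show "inf_P T f g \<le> f xb"
      unfolding inf_P_def by (rule INF_lower[OF xbE])
    show "f xb < \<infinity>"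
      by (simp add: f[OF xb(1)])
  qed
  moreover have "- \<infinity> \<le> inf_P T f g"
    by simp
  ultimately show ?thesis
    using stable by (intro conjI)
qed

end
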